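(* Let $T:[0,1]\to[0,1]$ be an expanding Markov map with a finite partition, and let $\nu$ be a $T$-invariant ergodic Borel probability measure on $[0,1]$. Then for every $\kappa>0$, both $x\mapsto\lambda(\mathcal U^\kappa(x))$ and $x\mapsto\dim_H\mathcal U^\kappa(x)$ are constant $\nu$-almost surely.
   Context: An expanding Markov map with a finite partition is a map $T:[0,1]\to[0,1]$ for which there are points $0=a_0<a_1<\dots<a_Q=1$, with $I(i)=(a_i,a_{i+1})$ for $i=0,\dots,Q-1$, such that: (1) there are an integer $n_0$ and a real $\rho>1$ with $|(T^{n_0})'|\ge\rho$; (2) $T$ is strictly monotonic on each $I(i)$ and extends to a $C^2$ function on each $\overline{I(i)}$; (3) if $I(j)\cap T(I(k))\ne\emptyset$ then $I(j)\subset T(I(k))$; (4) there is an integer $R$ such that $I(j)\subset\bigcup_{n=1}^R T^n(I(k))$ for all $j,k$; (5) for every $k$, $\sup_{(x,y,z)\in I(k)^3}|T''(x)|/(|T'(y)||T'(z)|)<\infty$. $\lambda$ denotes Lebesgue measure on $[0,1]$, $\dim_H$ Hausdorff dimension, $B(x,r)$ the open ball of center $x$ and radius $r$. For $\kappa>0$ and $x\in[0,1]$, $\mathcal U^\kappa(x)=\{y\in[0,1]:\text{for all sufficiently large } N \text{ there is } 1\le n\le N \text{ with } |T^nx-y|<N^{-\kappa}\}=\bigcup_{i\ge1}\bigcap_{N\ge i}\bigcup_{n=1}^N B(T^nx,N^{-\kappa})$. *)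

theory Defs
  imports "HOL-Probability.Probability"
begin

definition part_int :: "(nat \<Rightarrow> real) \<Rightarrow> nat \<Rightarrow> real set" where
  "part_int a i = {a i<..<a (Suc i)}"

definition expanding_markov_map :: "(real \<Rightarrow> real) \<Rightarrow> bool" where
  "expanding_markov_map T \<longleftrightarrow>
     T ` {0..1} \<subseteq> {0..1} \<and>
     (\<exists>(a :: nat \<Rightarrow> real) (Q :: nat).
        Q \<ge> 1 \<and> a 0 = 0 \<and> a Q = 1 \<and> (\<forall>i<Q. a i < a (Suc i)) \<and>
        \<comment> \<open>(1) expansion of an iterate (at every point whose first n0 orbit points
             lie in the interiors of the partition intervals, where T^n0 is differentiable)\<close>
        (\<exists>(n0 :: nat) (\<rho> :: real). n0 \<ge> 1 \<and> \<rho> > 1 \<and>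
           (\<forall>x. (\<forall>k<n0. \<exists>i<Q. (T ^^ k) x \<in> part_int a i) \<longrightarrow>
               (\<exists>D. ((T ^^ n0) has_real_derivative D) (at x) \<and> \<bar>D\<bar> \<ge> \<rho>))) \<and>
        \<comment> \<open>(2) strict monotonicity and C^2 extension to the closed intervals\<close>
        (\<forall>i<Q. (strict_mono_on (part_int a i) T \<or> strict_mono_on (part_int a i) (\<lambda>x. - T x)) \<and>
           (\<exists>g g' g''. (\<forall>x\<in>{a i..a (Suc i)}.
                 (g has_real_derivative g' x) (at x within {a i..a (Suc i)}) \<and>
                 (g' has_real_derivative g'' x) (at x within {a i..a (Suc i)})) \<and>
              continuous_on {a i..a (Suc i)} g'' \<and>
              (\<forall>x\<in>part_int a i. T x = g x))) \<and>
        \<comment> \<open>(3) Markov property\<close>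
        (\<forall>j<Q. \<forall>k<Q. part_int a j \<inter> T ` part_int a k \<noteq> {} \<longrightarrow>
             part_int a j \<subseteq> T ` part_int a k) \<and>
        \<comment> \<open>(4) transitivity / covering\<close>
        (\<exists>R::nat. \<forall>j<Q. \<forall>k<Q. part_int a j \<subseteq> (\<Union>n\<in>{1..R}. (T ^^ n) ` part_int a k)) \<and>
        \<comment> \<open>(5) bounded distortion: sup |T''(x)| / (|T'(y)| |T'(z)|) < \<infinity>\<close>
        (\<forall>k<Q. \<exists>C::real. \<forall>x\<in>part_int a k. \<forall>y\<in>part_int a k. \<forall>z\<in>part_int a k.
             \<bar>deriv (deriv T) x\<bar> \<le> C * (\<bar>deriv T y\<bar> * \<bar>deriv T z\<bar>)))"

definition invariant_ergodic_prob :: "(real \<Rightarrow> real) \<Rightarrow> real measure \<Rightarrow> bool" where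
  "invariant_ergodic_prob T \<nu> \<longleftrightarrow>
     prob_space \<nu> \<and> space \<nu> = {0..1} \<and> sets \<nu> = sets (restrict_space borel {0..1}) \<and>
     T \<in> measurable \<nu> \<nu> \<and>
     (\<forall>A\<in>sets \<nu>. emeasure \<nu> (T -` A \<inter> space \<nu>) = emeasure \<nu> A) \<and>
     (\<forall>A\<in>sets \<nu>. T -` A \<inter> space \<nu> = A \<longrightarrow> emeasure \<nu> A = 0 \<or> emeasure \<nu> A = 1)"

definition hausdorff_content :: "real \<Rightarrow> real \<Rightarrow> 'a::metric_space set \<Rightarrow> ennreal" where
  "hausdorff_content s \<delta> E =
     (INF U \<in> {U :: nat \<Rightarrow> 'a set. E \<subseteq> (\<Union>i. U i) \<and> (\<forall>i. bounded (U i) \<and> diameter (U i) \<le> \<delta>)}.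
        (\<Sum>i. ennreal (diameter (U i) powr s)))"

definition hausdorff_measure :: "real \<Rightarrow> 'a::metric_space set \<Rightarrow> ennreal" where
  "hausdorff_measure s E = (SUP \<delta> \<in> {0<..}. hausdorff_content s \<delta> E)"

text \<open>dim_H E = inf { s > 0 : H^s(E) = 0 }, as an extended real (infinity if the set is empty).\<close>
definition hausdorff_dim :: "'a::metric_space set \<Rightarrow> ereal" where
  "hausdorff_dim E = (INF s \<in> {s::real. s > 0 \<and> hausdorff_measure s E = 0}. ereal s)"

definition U_kappa :: "(real \<Rightarrow> real) \<Rightarrow> real \<Rightarrow> real \<Rightarrow> real set" where
  "U_kappa T \<kappa> x = {0..1} \<inter>
     (\<Union>i\<in>{1..}. \<Inter>N\<in>{i..}. \<Union>n\<in>{1..N}. ball ((T ^^ n) x) (real N powr (- \<kappa>)))"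

end

theory Submission
  imports Defs
begin

text \<open>
  If \<open>y \<in> U\<^sup>\<kappa>(x)\<close> and \<open>y \<noteq> T x\<close>, then for large \<open>N\<close> the visit at time \<open>1\<close> is useless, so
  \<open>U\<^sup>\<kappa>(x) - {T x} \<subseteq> U\<^sup>\<kappa>(T x)\<close>. Hence Lebesgue measure and Hausdorff dimension of \<open>U\<^sup>\<kappa>\<close> do not
  decrease along orbits, and a measurable function with this property is almost surely constant by
  ergodicity.

  Measurability of the dimension is the delicate point. Replacing open by closed balls changes
  \<open>U\<^sup>\<kappa>(x)\<close> only by points at distance exactly \<open>N\<^sup>-\<^sup>\<kappa>\<close> from some \<open>T\<^sup>n x\<close>, that is by a countable set,
  and turns it into a countable union of compact sets. That a compact set is null for the
  \<open>s\<close>-dimensional Hausdorff measure can be tested on finite covers by rational intervals, and that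
  such a compact set lies in a given open set is a countable condition on the orbit of \<open>x\<close>.
\<close>

section \<open>Hausdorff null sets through countable covers by rational intervals\<close>

definition rat_intervals_cover ::
    "real \<Rightarrow> real \<Rightarrow> real set \<Rightarrow> (nat \<Rightarrow> rat) \<Rightarrow> (nat \<Rightarrow> rat) \<Rightarrow> bool" where
  "rat_intervals_cover s \<epsilon> E p q \<longleftrightarrow> (\<forall>i. p i \<le> q i) \<and>
     E \<subseteq> (\<Union>i. {of_rat (p i)<..<of_rat (q i)}) \<and>
     (\<Sum>i. ennreal ((of_rat (q i) - of_rat (p i)) powr s)) \<le> ennreal \<epsilon>"

text \<open>A one-scale form of nullity for the s-dimensional Hausdorff measure. No mesh bound
  appears, because for s > 0 a small sum already forces every interval to be short. Rational
  endpoints prepare for countable quantification, and intervals with \<open>p i = q i\<close> are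
  empty and cost 0, so finite covers fit in by padding.\<close>

definition interval_null :: "real \<Rightarrow> real set \<Rightarrow> bool" where
  "interval_null s E \<longleftrightarrow> (\<forall>\<epsilon>>0. \<exists>p q. rat_intervals_cover s \<epsilon> E p q)"

lemma interval_nullD:
  assumes "interval_null s E" "\<epsilon> > 0"
  obtains p q where "\<And>i. p i \<le> q i" "E \<subseteq> (\<Union>i. {of_rat (p i)<..<of_rat (q i)})"
    "(\<Sum>i. ennreal ((of_rat (q i) - of_rat (p i)) powr s)) \<le> ennreal \<epsilon>"
  using assms unfolding interval_null_def rat_intervals_cover_def by blast

lemma interval_null_mono:
  assumes "interval_null s F" "E \<subseteq> F"
  shows "interval_null s E"
  using assms unfolding interval_null_def rat_intervals_cover_def by (meson order_trans)

lemma suminf_half_powers_ennreal: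
  assumes "0 \<le> \<epsilon>"
  shows "(\<Sum>i. ennreal (\<epsilon> * (1/2) ^ Suc i)) = ennreal \<epsilon>"
proof (rule suminf_ennreal_eq)
  show "(\<lambda>i. \<epsilon> * (1/2) ^ Suc i) sums \<epsilon>"
    using sums_mult[OF power_half_series, of \<epsilon>] by simp
qed (use assms in auto)

text \<open>Cover \<open>E n\<close> at cost \<open>\<epsilon> * (1/2) ^ Suc n\<close> and flatten
  the doubly indexed family along \<open>prod_decode\<close>; the costs add up to at most
  \<epsilon>.\<close>

lemma interval_null_UN:
  assumes "\<And>n::nat. interval_null s (E n)"
  shows "interval_null s (\<Union>n. E n)"
  unfolding interval_null_def
proof (intro allI impI)
  fix \<epsilon> :: real
  assume "\<epsilon> > 0"
  have "\<exists>p q. rat_intervals_cover s (\<epsilon> * (1/2) ^ Suc n) (E n) p q" for n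
    using assms[of n] \<open>\<epsilon> > 0\<close> unfolding interval_null_def by simp
  then obtain p q where "\<And>n. rat_intervals_cover s (\<epsilon> * (1/2) ^ Suc n) (E n) (p n) (q n)"
    by metis
  then have pq: "\<And>n i. p n i \<le> q n i"
     "\<And>n. E n \<subseteq> (\<Union>i. {of_rat (p n i)<..<of_rat (q n i)})"
     "\<And>n. (\<Sum>i. ennreal ((of_rat (q n i) - of_rat (p n i)) powr s)) \<le> ennreal (\<epsilon> * (1/2) ^ Suc n)"
    unfolding rat_intervals_cover_def by blast+
  define f where "f = (\<lambda>(n, i). ennreal ((of_rat (q n i) - of_rat (p n i)) powr s))"
  define p' where "p' k = (case prod_decode k of (n, i) \<Rightarrow> p n i)" for k
  define q' where "q' k = (case prod_decode k of (n, i) \<Rightarrow> q n i)" for k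
  have "(\<Sum>k. ennreal ((of_rat (q' k) - of_rat (p' k)) powr s)) = (\<Sum>k. f (prod_decode k))"
    by (simp add: f_def p'_def q'_def case_prod_unfold)
  also have "\<dots> = (\<Sum>n. \<Sum>i. f (n, i))"
    by (rule suminf_ennreal_2dimen) simp
  also have "\<dots> \<le> (\<Sum>n. ennreal (\<epsilon> * (1/2) ^ Suc n))"
    using pq(3) by (intro suminf_le) (auto simp: f_def)
  also have "\<dots> = ennreal \<epsilon>"
    using \<open>\<epsilon> > 0\<close> by (intro suminf_half_powers_ennreal) simp
  finally have sum: "(\<Sum>k. ennreal ((of_rat (q' k) - of_rat (p' k)) powr s)) \<le> ennreal \<epsilon>" .
  have cover: "(\<Union>n. E n) \<subseteq> (\<Union>k. {of_rat (p' k)<..<of_rat (q' k)})"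
  proof
    fix y assume "y \<in> (\<Union>n. E n)"
    then obtain n i where "y \<in> {of_rat (p n i)<..<of_rat (q n i)}"
      using pq(2) by blast
    then have "y \<in> {of_rat (p' (prod_encode (n, i)))<..<of_rat (q' (prod_encode (n, i)))}"
      by (simp add: p'_def q'_def)
    then show "y \<in> (\<Union>k. {of_rat (p' k)<..<of_rat (q' k)})"
      by blast
  qed
  have "p' k \<le> q' k" for k
    by (simp add: p'_def q'_def case_prod_unfold pq(1))
  with sum cover show "\<exists>p q. rat_intervals_cover s \<epsilon> (\<Union>n. E n) p q"
    unfolding rat_intervals_cover_def by blast
qed

lemma ennreal_suminf_le_imp_le:
  assumes "(\<Sum>i. ennreal (f i)) \<le> ennreal \<epsilon>" "0 \<le> \<epsilon>"
  shows "f i \<le> \<epsilon>"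
proof -
  have "ennreal (f i) \<le> (\<Sum>i. ennreal (f i))"
    using sum_le_suminf[of "\<lambda>i. ennreal (f i)" "{i}"] by simp
  also note assms(1)
  finally show ?thesis
    using assms(2) by simp
qed

lemma powr_le_imp_le:
  assumes "x powr s \<le> y powr s" "0 < s" "0 \<le> x" "0 \<le> (y::real)"
  shows "x \<le> y"
  using assms powr_less_mono2[of s y x] by (meson not_le)

text \<open>For lengths at most 1 a larger exponent gives a smaller power, so a cover with only such
  lengths serves both exponents.\<close>

lemma interval_null_mono_exponent:
  assumes "interval_null s E" "0 < s" "s \<le> t"
  shows "interval_null t E"
  unfolding interval_null_def
proof (intro allI impI)
  fix \<epsilon> :: real
  assume "\<epsilon> > 0"
  \<comment> \<open>Capping the budget at 1 bounds each single term by \<open>1 powr s\<close>,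
    hence each length by 1.\<close>
  then have "min \<epsilon> 1 > 0" by simp
  from interval_nullD[OF assms(1) this] obtain p q :: "nat \<Rightarrow> rat" where pq: "\<And>i. p i \<le> q i"
    "E \<subseteq> (\<Union>i. {of_rat (p i)<..<of_rat (q i)})"
    and sum: "(\<Sum>i. ennreal ((of_rat (q i) - of_rat (p i)) powr s)) \<le> ennreal (min \<epsilon> 1)"
    by blast
  have ge: "(of_rat (q i) - of_rat (p i) :: real) \<ge> 0" for i
    using pq(1)[of i] by (simp add: of_rat_less_eq)
  have "(of_rat (q i) - of_rat (p i) :: real) powr s \<le> 1 powr s" for i
    using ennreal_suminf_le_imp_le[OF sum, of i] \<open>\<epsilon> > 0\<close> by simp
  then have le1: "(of_rat (q i) - of_rat (p i) :: real) \<le> 1" for i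
    using powr_le_imp_le[OF _ assms(2) ge] by simp
  have "(\<Sum>i. ennreal ((of_rat (q i) - of_rat (p i)) powr t))
      \<le> (\<Sum>i. ennreal ((of_rat (q i) - of_rat (p i)) powr s))"
    using ge le1 assms by (intro suminf_le ennreal_leI powr_mono') auto
  also have "\<dots> \<le> ennreal \<epsilon>"
    using sum \<open>\<epsilon> > 0\<close> by (metis ennreal_leI min.cobounded1 order_trans)
  finally show "\<exists>p q. rat_intervals_cover t \<epsilon> E p q"
    unfolding rat_intervals_cover_def using pq by blast
qed

text \<open>On the line, a nonempty set of diameter d lies in the interval from \<open>Inf U\<close>
  to \<open>Inf U + d\<close>. Widening it to rational endpoints is cheap, since
  \<open>(d + t) powr s\<close> tends to \<open>d powr s\<close> as t decreases to 0.\<close>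

lemma bounded_subset_rat_interval:
  fixes U :: "real set"
  assumes "bounded U" "0 < s" "0 < \<eta>"
  obtains p q :: rat where "p \<le> q" "U \<subseteq> {of_rat p<..<of_rat q}"
    "(of_rat q - of_rat p) powr s \<le> diameter U powr s + \<eta>"
proof (cases "U = {}")
  case True
  then show ?thesis using that[of 0 0] assms by auto
next
  case False
  define d where "d = diameter U"
  have "d \<ge> 0" using diameter_ge_0[OF assms(1)] by (simp add: d_def)
  have "((\<lambda>t. (d + t) powr s) \<longlongrightarrow> (d + 0) powr s) (at_right 0)"
    using \<open>d \<ge> 0\<close> assms(2)
    by (intro tendsto_powr' tendsto_intros) (auto simp: eventually_at_filter)
  then have "eventually (\<lambda>t. (d + t) powr s < d powr s + \<eta>) (at_right 0)"
    using assms(3) by (intro order_tendstoD(2)) auto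
  then have "eventually (\<lambda>t. (d + t) powr s < d powr s + \<eta> \<and> 0 < t) (at_right 0)"
    using eventually_at_right_less by eventually_elim auto
  then obtain t where t: "(d + t) powr s < d powr s + \<eta>" "0 < t"
    using eventually_happens'[OF trivial_limit_at_right_real] by blast
  define m where "m = Inf U"
  have lb: "m \<le> x" if "x \<in> U" for x
    unfolding m_def using that assms(1) by (intro cInf_lower bounded_imp_bdd_below)
  have ub: "x \<le> m + d" if "x \<in> U" for x
  proof -
    have "x - d \<le> y" if "y \<in> U" for y
      using diameter_bounded_bound[OF assms(1) \<open>x \<in> U\<close> that] by (simp add: d_def dist_real_def)
    then have "x - d \<le> m"
      unfolding m_def by (rule cInf_greatest[OF False])
    then show ?thesis by simp
  qed
  \<comment> \<open>Less than \<open>t/2\<close> is added at each end, so the total length stays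
    below \<open>d + t\<close>.\<close>
  obtain p :: rat where p: "m - t/2 < of_rat p" "of_rat p < m"
    using of_rat_dense[of "m - t/2" m] t by auto
  obtain q :: rat where q: "m + d < of_rat q" "of_rat q < m + d + t/2"
    using of_rat_dense[of "m + d" "m + d + t/2"] t by auto
  have pq: "of_rat p < (of_rat q :: real)"
    using p q \<open>d \<ge> 0\<close> by linarith
  show ?thesis
  proof (rule that)
    show "p \<le> q" using pq by (simp add: of_rat_less)
    show "U \<subseteq> {of_rat p<..<of_rat q}"
      using lb ub p q by fastforce
    have "(of_rat q - of_rat p) powr s \<le> (d + t) powr s"
      using p q pq assms by (intro powr_mono2) auto
    with t show "(of_rat q - of_rat p) powr s \<le> diameter U powr s + \<eta>"
      by (simp add: d_def)
  qed
qed

text \<open>The mesh does not matter for null sets: a total cost of at most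
  \<open>\<delta> powr s\<close> keeps every interval no longer than \<delta>. Conversely, the
  content at the single scale 1 already supplies cheap covers, whose members are then replaced by
  rational intervals.\<close>

lemma hausdorff_measure_eq_0_iff:
  assumes "0 < s"
  shows "hausdorff_measure s E = 0 \<longleftrightarrow> interval_null s E"
proof
  assume null: "interval_null s E"
  have "hausdorff_content s \<delta> E \<le> 0 + ennreal \<epsilon>" if "\<delta> > 0" "\<epsilon> > 0" for \<delta> \<epsilon>
  proof -
    have "min \<epsilon> (\<delta> powr s) > 0" using that by simp
    from interval_nullD[OF null this] obtain p q :: "nat \<Rightarrow> rat" where pq: "\<And>i. p i \<le> q i"
      "E \<subseteq> (\<Union>i. {of_rat (p i)<..<of_rat (q i)})"
      and sum: "(\<Sum>i. ennreal ((of_rat (q i) - of_rat (p i)) powr s)) \<le> ennreal (min \<epsilon> (\<delta> powr s))"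
      by blast
    define U where "U i = {of_rat (p i)<..<(of_rat (q i) :: real)}" for i
    have diam: "diameter (U i) = of_rat (q i) - of_rat (p i)" for i
      using pq(1)[of i] by (auto simp: U_def of_rat_less of_rat_less_eq)
    have ge: "(of_rat (q i) - of_rat (p i) :: real) \<ge> 0" for i
      using pq(1)[of i] by (simp add: of_rat_less_eq)
    have "(of_rat (q i) - of_rat (p i) :: real) powr s \<le> \<delta> powr s" for i
      using ennreal_suminf_le_imp_le[OF sum, of i] that by simp
    then have "(of_rat (q i) - of_rat (p i) :: real) \<le> \<delta>" for i
      using powr_le_imp_le[OF _ assms ge] that by simp
    then have "U \<in> {U. E \<subseteq> (\<Union>i. U i) \<and> (\<forall>i. bounded (U i) \<and> diameter (U i) \<le> \<delta>)}"
      using pq(2) by (simp add: diam) (simp add: U_def)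
    then have "hausdorff_content s \<delta> E \<le> (\<Sum>i. ennreal (diameter (U i) powr s))"
      unfolding hausdorff_content_def by (rule INF_lower)
    also have "\<dots> \<le> ennreal (min \<epsilon> (\<delta> powr s))"
      using sum by (simp add: diam)
    also have "\<dots> \<le> 0 + ennreal \<epsilon>"
      by (simp add: ennreal_leI)
    finally show ?thesis .
  qed
  then have "hausdorff_content s \<delta> E \<le> 0" if "\<delta> > 0" for \<delta>
    using that by - (rule ennreal_le_epsilon, simp)
  then show "hausdorff_measure s E = 0"
    unfolding hausdorff_measure_def by (intro antisym SUP_least) auto
next
  assume "hausdorff_measure s E = 0"
  moreover have "hausdorff_content s 1 E \<le> hausdorff_measure s E"
    unfolding hausdorff_measure_def by (intro SUP_upper) auto
  ultimately have content: "hausdorff_content s 1 E = 0" by simp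
  show "interval_null s E"
    unfolding interval_null_def
  proof (intro allI impI)
    fix \<epsilon> :: real
    assume "\<epsilon> > 0"
    then have "hausdorff_content s 1 E < ennreal (\<epsilon>/2)"
      by (simp add: content)
    then obtain U where U: "E \<subseteq> (\<Union>i. U i)" "\<And>i::nat. bounded (U i)"
      "(\<Sum>i. ennreal (diameter (U i) powr s)) < ennreal (\<epsilon>/2)"
      unfolding hausdorff_content_def INF_less_iff by blast
    have "\<exists>(p::rat) q. p \<le> q \<and> U i \<subseteq> {of_rat p<..<of_rat q} \<and>
        (of_rat q - of_rat p) powr s \<le> diameter (U i) powr s + \<epsilon>/2 * (1/2) ^ Suc i" for i
    proof -
      \<comment> \<open>One half of \<epsilon> pays for the given cover, the other half, split
        geometrically, for enlarging its sets.\<close>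
      have "0 < \<epsilon>/2 * (1/2) ^ Suc i" using \<open>\<epsilon> > 0\<close> by simp
      from bounded_subset_rat_interval[OF U(2)[of i] assms this] show ?thesis by blast
    qed
    then have "\<exists>p q. \<forall>i. p i \<le> q i \<and> U i \<subseteq> {of_rat (p i)<..<of_rat (q i)} \<and>
        (of_rat (q i) - of_rat (p i)) powr s \<le> diameter (U i) powr s + \<epsilon>/2 * (1/2) ^ Suc i"
      by metis
    then obtain p q :: "nat \<Rightarrow> rat" where pq: "\<And>i. p i \<le> q i"
      "\<And>i. U i \<subseteq> {of_rat (p i)<..<of_rat (q i)}"
      "\<And>i. (of_rat (q i) - of_rat (p i)) powr s \<le> diameter (U i) powr s + \<epsilon>/2 * (1/2) ^ Suc i"
      by blast
    have "(\<Sum>i. ennreal ((of_rat (q i) - of_rat (p i)) powr s))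
        \<le> (\<Sum>i. ennreal (diameter (U i) powr s) + ennreal (\<epsilon>/2 * (1/2) ^ Suc i))"
    proof (intro suminf_le allI)
      fix i
      show "ennreal ((of_rat (q i) - of_rat (p i)) powr s)
          \<le> ennreal (diameter (U i) powr s) + ennreal (\<epsilon>/2 * (1/2) ^ Suc i)"
        using ennreal_leI[OF pq(3)[of i]] \<open>\<epsilon> > 0\<close> by (subst (asm) ennreal_plus) auto
    qed auto
    also have "\<dots> = (\<Sum>i. ennreal (diameter (U i) powr s)) + (\<Sum>i. ennreal (\<epsilon>/2 * (1/2) ^ Suc i))"
      by (rule suminf_add[symmetric]) auto
    also have "\<dots> = (\<Sum>i. ennreal (diameter (U i) powr s)) + ennreal (\<epsilon>/2)"
      using \<open>\<epsilon> > 0\<close> by (subst suminf_half_powers_ennreal) auto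
    also have "\<dots> \<le> ennreal (\<epsilon>/2) + ennreal (\<epsilon>/2)"
      using U(3) by (intro add_mono) auto
    also have "\<dots> = ennreal \<epsilon>"
      using \<open>\<epsilon> > 0\<close> by (subst ennreal_plus[symmetric]) auto
    finally have "(\<Sum>i. ennreal ((of_rat (q i) - of_rat (p i)) powr s)) \<le> ennreal \<epsilon>" .
    moreover have "E \<subseteq> (\<Union>i. {of_rat (p i)<..<of_rat (q i)})"
      using U(1) pq(2) by blast
    ultimately show "\<exists>p q. rat_intervals_cover s \<epsilon> E p q"
      unfolding rat_intervals_cover_def using pq(1) by blast
  qed
qed

lemma interval_null_countable:
  assumes "countable E" "0 < s"
  shows "interval_null s E"
proof (cases "E = {}")
  case True
  have "interval_null s {}"
    unfolding interval_null_def rat_intervals_cover_def by (auto intro!: exI[of _ "\<lambda>_. 0"])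
  then show ?thesis using True by simp
next
  case False
  have sing: "interval_null s {y}" for y
    unfolding interval_null_def
  proof (intro allI impI)
    fix \<epsilon> :: real assume "\<epsilon> > 0"
    obtain p q :: rat where pq: "p \<le> q" "{y} \<subseteq> {of_rat p<..<of_rat q}"
        "(of_rat q - of_rat p) powr s \<le> diameter {y} powr s + \<epsilon>"
      using bounded_subset_rat_interval[of "{y}" s \<epsilon>] assms \<open>\<epsilon> > 0\<close> by auto
    \<comment> \<open>Only the interval at index 0 is genuine; all others run from \<open>p\<close>
      to \<open>p\<close>, are empty and cost 0.\<close>
    define q' where "q' i = (if i = 0 then q else p)" for i :: nat
    have "(\<Sum>i. ennreal ((of_rat (q' i) - of_rat p) powr s))
        = (\<Sum>i\<in>{0}. ennreal ((of_rat (q' i) - of_rat p) powr s))"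
      by (rule suminf_finite) (auto simp: q'_def)
    also have "\<dots> \<le> ennreal \<epsilon>"
      using pq(3) by (simp add: q'_def ennreal_leI)
    finally have "(\<Sum>i. ennreal ((of_rat (q' i) - of_rat p) powr s)) \<le> ennreal \<epsilon>" .
    moreover have "{y} \<subseteq> (\<Union>i. {of_rat p<..<of_rat (q' i)})"
      using pq(2) by (auto simp: q'_def intro!: exI[of _ 0])
    moreover have "p \<le> q' i" for i
      using pq(1) by (simp add: q'_def)
    ultimately show "\<exists>p q. rat_intervals_cover s \<epsilon> {y} p q"
      unfolding rat_intervals_cover_def by (intro exI[of _ "\<lambda>_. p"] exI[of _ q']) auto
  qed
  have "interval_null s (\<Union>n. {from_nat_into E n})"
    by (rule interval_null_UN) (rule sing)
  moreover have "(\<Union>n. {from_nat_into E n}) = E"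
    using range_from_nat_into[OF False assms(1)] by auto
  ultimately show ?thesis by simp
qed

lemma interval_null_Un_countable:
  assumes "interval_null s E" "countable C" "0 < s"
  shows "interval_null s (E \<union> C)"
proof -
  have "interval_null s (\<Union>n::nat. if n = 0 then E else C)"
    using assms interval_null_countable by (intro interval_null_UN) auto
  then show ?thesis
    by (rule interval_null_mono) (auto split: if_splits)
qed

section \<open>Finite rational covers of compact sets\<close>

definition rat_cover :: "(rat \<times> rat) list \<Rightarrow> real set" where
  "rat_cover L = (\<Union>(p, q)\<in>set L. {of_rat p<..<of_rat q})"

text \<open>Lists of pairs of rationals form a countable type, so a quantifier over this set
  preserves measurability.\<close>

definition small_rat_lists :: "real \<Rightarrow> real \<Rightarrow> (rat \<times> rat) list set" where
  "small_rat_lists s \<epsilon> = {L. (\<forall>(p, q)\<in>set L. p \<le> q) \<and>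
     (\<Sum>(p, q)\<leftarrow>L. (of_rat q - of_rat p) powr s) \<le> \<epsilon>}"

lemma open_rat_cover: "open (rat_cover L)"
  unfolding rat_cover_def by auto

text \<open>Compactness extracts a finite subcover, whose cost is a partial sum of the series;
  conversely a finite list is padded by empty intervals. Nullity thus becomes a countable
  combination of inclusions in open sets.\<close>

lemma interval_null_compact_iff:
  assumes "compact E"
  shows "interval_null s E \<longleftrightarrow> (\<forall>k. \<exists>L\<in>small_rat_lists s (1 / Suc k). E \<subseteq> rat_cover L)"
proof (intro iffI allI)
  fix k
  assume null: "interval_null s E"
  have "0 < 1 / real (Suc k)" by simp
  from interval_nullD[OF null this] obtain p q :: "nat \<Rightarrow> rat" where pq: "\<And>i. p i \<le> q i"
    "E \<subseteq> (\<Union>i. {of_rat (p i)<..<of_rat (q i)})"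
    and sum: "(\<Sum>i. ennreal ((of_rat (q i) - of_rat (p i)) powr s)) \<le> ennreal (1 / real (Suc k))"
    by blast
  obtain I where I: "finite I" "E \<subseteq> (\<Union>i\<in>I. {of_rat (p i)<..<of_rat (q i)})"
    using compactE_image[OF assms, of UNIV "\<lambda>i. {of_rat (p i)<..<of_rat (q i)}"] pq(2) by auto
  define L where "L = map (\<lambda>i. (p i, q i)) (sorted_list_of_set I)"
  have "ennreal (\<Sum>(p, q)\<leftarrow>L. (of_rat q - of_rat p) powr s)
      = ennreal (\<Sum>i\<in>I. (of_rat (q i) - of_rat (p i)) powr s)"
    using I(1) by (simp add: L_def comp_def sum_list_distinct_conv_sum_set)
  also have "\<dots> = (\<Sum>i\<in>I. ennreal ((of_rat (q i) - of_rat (p i)) powr s))"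
    by (rule sum_ennreal[symmetric]) simp
  also have "\<dots> \<le> (\<Sum>i. ennreal ((of_rat (q i) - of_rat (p i)) powr s))"
    using I(1) by (intro sum_le_suminf) auto
  also note sum
  finally have "L \<in> small_rat_lists s (1 / Suc k)"
    using pq(1) I(1) by (subst (asm) ennreal_le_iff) (auto simp: small_rat_lists_def L_def)
  moreover have "E \<subseteq> rat_cover L"
    using I by (auto simp: rat_cover_def L_def)
  ultimately show "\<exists>L\<in>small_rat_lists s (1 / Suc k). E \<subseteq> rat_cover L" by blast
next
  assume *: "\<forall>k. \<exists>L\<in>small_rat_lists s (1 / Suc k). E \<subseteq> rat_cover L"
  show "interval_null s E"
    unfolding interval_null_def
  proof (intro allI impI)
    fix \<epsilon> :: real assume "\<epsilon> > 0"
    then obtain k where k: "1 / real (Suc k) < \<epsilon>"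
      using nat_approx_posE by (metis of_nat_Suc)
    obtain L where L: "L \<in> small_rat_lists s (1 / Suc k)" "E \<subseteq> rat_cover L"
      using * by blast
    define p where "p i = (if i < length L then fst (L ! i) else 0)" for i
    define q where "q i = (if i < length L then snd (L ! i) else 0)" for i
    have "(\<Sum>i. ennreal ((of_rat (q i) - of_rat (p i)) powr s))
        = (\<Sum>i<length L. ennreal ((of_rat (q i) - of_rat (p i)) powr s))"
      by (rule suminf_finite) (auto simp: p_def q_def)
    also have "\<dots> = ennreal (\<Sum>i<length L. (of_rat (q i) - of_rat (p i)) powr s)"
      by (rule sum_ennreal) simp
    also have "(\<Sum>i<length L. (of_rat (q i) - of_rat (p i)) powr s)
        = (\<Sum>(p, q)\<leftarrow>L. (of_rat q - of_rat p) powr s :: real)"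
      by (simp add: sum_list_sum_nth p_def q_def case_prod_unfold atLeast0LessThan)
    also have "ennreal \<dots> \<le> ennreal \<epsilon>"
      using L(1) k by (intro ennreal_leI) (auto simp: small_rat_lists_def)
    finally have sum: "(\<Sum>i. ennreal ((of_rat (q i) - of_rat (p i)) powr s)) \<le> ennreal \<epsilon>" .
    have le: "p i \<le> q i" for i
      using L(1) nth_mem[of i L] by (fastforce simp: small_rat_lists_def p_def q_def)
    have cover: "E \<subseteq> (\<Union>i. {of_rat (p i)<..<of_rat (q i)})"
    proof
      fix y assume "y \<in> E"
      with L(2) obtain i where "i < length L" "y \<in> {of_rat (fst (L ! i))<..<of_rat (snd (L ! i))}"
        by (force simp: rat_cover_def in_set_conv_nth)
      then have "y \<in> {of_rat (p i)<..<of_rat (q i)}"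
        by (simp add: p_def q_def)
      then show "y \<in> (\<Union>i. {of_rat (p i)<..<of_rat (q i)})" by blast
    qed
    show "\<exists>p q. rat_intervals_cover s \<epsilon> E p q"
      unfolding rat_intervals_cover_def using le cover sum by blast
  qed
qed

section \<open>Ergodicity and functions that do not decrease along orbits\<close>

lemma (in prob_space) backward_subinvariant_trivial:
  assumes T: "T \<in> measurable M M"
    and inv: "\<And>A. A \<in> sets M \<Longrightarrow> emeasure M (T -` A \<inter> space M) = emeasure M A"
    and erg: "\<And>A. A \<in> sets M \<Longrightarrow> T -` A \<inter> space M = A \<Longrightarrow> emeasure M A = 0 \<or> emeasure M A = 1"
    and A: "A \<in> sets M" "T -` A \<inter> space M \<subseteq> A"
  shows "emeasure M A = 0 \<or> emeasure M A = 1"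
proof -
  \<comment> \<open>The preimages of \<open>A\<close> decrease to a strictly invariant set of the same measure.\<close>
  define B where "B n = ((\<lambda>C. T -` C \<inter> space M) ^^ n) A" for n
  have B0: "B 0 = A" and BSuc: "B (Suc n) = T -` B n \<inter> space M" for n
    by (simp_all add: B_def)
  have sets: "B n \<in> sets M" for n
    by (induction n) (use A T in \<open>auto simp: B0 BSuc intro: measurable_sets\<close>)
  have em: "emeasure M (B n) = emeasure M A" for n
    by (induction n) (use inv sets in \<open>auto simp: B0 BSuc\<close>)
  have step: "B (Suc n) \<subseteq> B n" for n
    by (induction n) (use A in \<open>auto simp: B0 BSuc\<close>)
  then have dec: "decseq B" by (rule decseq_SucI)
  have "emeasure M (\<Inter>n. B n) = (INF n. emeasure M (B n))"
    using sets dec by (intro INF_emeasure_decseq[symmetric]) (auto simp: emeasure_eq_measure)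
  also have "\<dots> = emeasure M A" by (simp add: em)
  finally have eq: "emeasure M (\<Inter>n. B n) = emeasure M A" .
  have "T -` (\<Inter>n. B n) \<inter> space M = (\<Inter>n. B (Suc n))"
    by (auto simp: BSuc)
  also have "\<dots> = (\<Inter>n. B n)"
    using step by blast
  finally show ?thesis
    using erg[of "\<Inter>n. B n"] sets by (simp add: eq)
qed

text \<open>If \<open>f (T x) \<le> c\<close> then \<open>f x \<le> c\<close>, so each sublevel set
  contains its preimage and has measure 0 or 1. Every threshold is therefore an almost sure upper
  bound or an almost sure strict lower bound, and the constant is where the two kinds meet.\<close>

lemma (in prob_space) AE_const_of_nondecreasing_along_orbits:
  fixes f :: "'a \<Rightarrow> ereal"
  assumes T: "T \<in> measurable M M"
    and inv: "\<And>A. A \<in> sets M \<Longrightarrow> emeasure M (T -` A \<inter> space M) = emeasure M A"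
    and erg: "\<And>A. A \<in> sets M \<Longrightarrow> T -` A \<inter> space M = A \<Longrightarrow> emeasure M A = 0 \<or> emeasure M A = 1"
    and f: "f \<in> borel_measurable M"
    and le: "\<And>x. x \<in> space M \<Longrightarrow> f x \<le> f (T x)"
  shows "\<exists>d. AE x in M. f x = d"
proof -
  have dich: "(AE x in M. f x \<le> c) \<or> (AE x in M. c < f x)" for c
  proof -
    define A where "A = {x \<in> space M. f x \<le> c}"
    have A: "A \<in> sets M" unfolding A_def using f by measurable
    have "T -` A \<inter> space M \<subseteq> A"
      using le by (force simp: A_def)
    then have "emeasure M A = 0 \<or> emeasure M A = 1"
      using backward_subinvariant_trivial[OF T inv erg A] by blast
    then show ?thesis
    proof
      assume "emeasure M A = 0"
      then have "AE x in M. x \<notin> A" using A by (intro AE_not_in) auto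
      then show ?thesis
        by (intro disjI2) (auto simp: A_def not_le elim!: AE_mp)
    next
      assume "emeasure M A = 1"
      then have "AE x in M. x \<in> A" using A
        by (simp add: emeasure_eq_measure prob_eq_1)
      then show ?thesis
        by (intro disjI1) (auto simp: A_def elim!: AE_mp)
    qed
  qed
  \<comment> \<open>This is the essential supremum of \<open>f\<close>.\<close>
  define d where "d = Inf {c. AE x in M. f x \<le> c}"
  \<comment> \<open>Rational thresholds leave only countably many exceptional null sets; density of
    the rationals then pins \<open>f x\<close> to \<open>d\<close>.\<close>
  have "AE x in M. \<forall>r::rat. d < ereal (of_rat r) \<longrightarrow> f x \<le> ereal (of_rat r)"
    unfolding AE_all_countable
  proof
    fix r :: rat
    show "AE x in M. d < ereal (of_rat r) \<longrightarrow> f x \<le> ereal (of_rat r)"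
    proof (cases "d < ereal (of_rat r)")
      case True
      then obtain c where c: "AE x in M. f x \<le> c" "c < ereal (of_rat r)"
        unfolding d_def Inf_less_iff by blast
      from c(1) show ?thesis by eventually_elim (use c(2) in auto)
    qed auto
  qed
  moreover have "AE x in M. \<forall>r::rat. ereal (of_rat r) < d \<longrightarrow> ereal (of_rat r) < f x"
    unfolding AE_all_countable
  proof
    fix r :: rat
    show "AE x in M. ereal (of_rat r) < d \<longrightarrow> ereal (of_rat r) < f x"
    proof (cases "ereal (of_rat r) < d")
      case True
      \<comment> \<open>A rational below \<open>d\<close> is not an essential upper bound, so
        \<open>dich\<close> makes it a strict lower bound almost everywhere.\<close>
      then have "\<not> (AE x in M. f x \<le> ereal (of_rat r))"
        unfolding d_def by (meson Inf_lower mem_Collect_eq not_le)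
      with dich have "AE x in M. ereal (of_rat r) < f x" by blast
      then show ?thesis by auto
    qed auto
  qed
  ultimately have "AE x in M. f x = d"
  proof eventually_elim
    case (elim x)
    have dense: "\<exists>r::rat. a < ereal (of_rat r) \<and> ereal (of_rat r) < b" if "a < b" for a b :: ereal
    proof -
      \<comment> \<open>Since \<open>a\<close> and \<open>b\<close> may be infinite, two reals
        between them are chosen first, and then a rational between those.\<close>
      obtain u where u: "a < ereal u" "ereal u < b"
        using ereal_dense2[OF \<open>a < b\<close>] by blast
      obtain v where v: "ereal u < ereal v" "ereal v < b"
        using ereal_dense2[OF u(2)] by blast
      obtain r :: rat where "u < of_rat r" "of_rat r < v"
        using of_rat_dense[of u v] v(1) by auto
      then have "ereal u < ereal (of_rat r)" "ereal (of_rat r) < ereal v" by simp_all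
      then show ?thesis using u v by (meson less_trans)
    qed
    show ?case
    proof (rule antisym; rule ccontr)
      assume "\<not> f x \<le> d"
      then obtain r :: rat where "d < ereal (of_rat r)" "ereal (of_rat r) < f x"
        using dense[of d "f x"] unfolding not_le by blast
      then show False using elim(1) by (meson not_le)
    next
      assume "\<not> d \<le> f x"
      then obtain r :: rat where "f x < ereal (of_rat r)" "ereal (of_rat r) < d"
        using dense[of "f x" d] unfolding not_le by blast
      then show False using elim(2) by (meson less_asym)
    qed
  qed
  then show ?thesis ..
qed

section \<open>Comparison of \<open>U_kappa\<close> at \<open>x\<close> and at
  \<open>T x\<close>\<close>

lemma powr_neg_eventually_less:
  assumes "\<kappa> > 0" "0 < (\<delta>::real)"
  obtains n0 :: nat where "\<And>N. N \<ge> n0 \<Longrightarrow> real N powr (- \<kappa>) < \<delta>"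
proof -
  have "(\<lambda>N. real N powr (- \<kappa>)) \<longlonglongrightarrow> 0"
    using assms(1) by (intro tendsto_neg_powr filterlim_real_sequentially) auto
  then have "eventually (\<lambda>N. real N powr (- \<kappa>) < \<delta>) sequentially"
    using assms(2) by (intro order_tendstoD(2)) auto
  then show ?thesis
    using that by (auto simp: eventually_sequentially)
qed

lemma mem_U_kappa_iff:
  "y \<in> U_kappa T \<kappa> x \<longleftrightarrow> y \<in> {0..1} \<and>
     (\<exists>i\<in>{1..}. \<forall>N\<in>{i..}. \<exists>n\<in>{1..N}. dist ((T ^^ n) x) y < real N powr (- \<kappa>))"
  by (simp only: U_kappa_def Int_iff UN_iff INT_iff mem_ball)

lemma U_kappa_shift_subset:
  assumes "\<kappa> > 0"
  shows "U_kappa T \<kappa> x \<subseteq> U_kappa T \<kappa> (T x) \<union> {T x}"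
proof
  fix y assume y: "y \<in> U_kappa T \<kappa> x"
  show "y \<in> U_kappa T \<kappa> (T x) \<union> {T x}"
  proof (cases "y = T x")
    case False
    from y obtain i where i: "i \<ge> 1" and y01: "y \<in> {0..1}"
      and hit: "\<And>N. N \<ge> i \<Longrightarrow> \<exists>n\<in>{1..N}. dist ((T ^^ n) x) y < real N powr (- \<kappa>)"
      unfolding mem_U_kappa_iff by auto
    have "0 < dist (T x) y" using False by simp
    from powr_neg_eventually_less[OF assms this] obtain n0
      where n0: "\<And>N. N \<ge> n0 \<Longrightarrow> real N powr (- \<kappa>) < dist (T x) y" by blast
    have *: "\<exists>n\<in>{1..N}. dist ((T ^^ n) (T x)) y < real N powr (- \<kappa>)" if N: "N \<ge> max i n0" for N
    proof -
      obtain n where n: "n \<in> {1..N}" "dist ((T ^^ n) x) y < real N powr (- \<kappa>)"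
        using hit[of N] N by auto
      \<comment> \<open>With time 1 ruled out, \<open>n - 1\<close> is still at least 1 and is an
        admissible visiting time for the orbit of \<open>T x\<close>.\<close>
      have "n \<noteq> 1" using n(2) n0[of N] N by auto
      then obtain m where m: "n = Suc m" "m \<ge> 1"
        using n(1) by (cases n) auto
      have "(T ^^ n) x = (T ^^ m) (T x)"
        by (simp add: m(1) funpow_swap1)
      then show ?thesis using n m by (intro bexI[of _ m]) auto
    qed
    have "\<exists>i\<in>{1..}. \<forall>N\<in>{i..}. \<exists>n\<in>{1..N}. dist ((T ^^ n) (T x)) y < real N powr (- \<kappa>)"
      by (rule bexI[of _ "max i n0"], rule ballI, rule *) (use i in auto)
    then show ?thesis
      using y01 by (simp add: mem_U_kappa_iff)
  qed simp
qed

section \<open>The closed-ball version of \<open>U_kappa\<close> and its compact pieces\<close>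

text \<open>With \<open>X\<close> the orbit of \<open>x\<close> and \<open>r N = N\<^sup>-\<^sup>\<kappa>\<close>, the compact pieces of the closed-ball version
  of \<open>U\<^sup>\<kappa>(x)\<close>.\<close>
definition closed_hits :: "(nat \<Rightarrow> real) \<Rightarrow> (nat \<Rightarrow> real) \<Rightarrow> nat \<Rightarrow> real set" where
  "closed_hits X r i = {0..1} \<inter> (\<Inter>N\<in>{i..}. \<Union>n\<in>{1..N}. cball (X n) (r N))"

lemma mem_closed_hits_iff:
  "y \<in> closed_hits X r i \<longleftrightarrow> y \<in> {0..1} \<and> (\<forall>N\<in>{i..}. \<exists>n\<in>{1..N}. dist (X n) y \<le> r N)"
  by (simp only: closed_hits_def Int_iff UN_iff INT_iff mem_cball)

lemma compact_closed_hits: "compact (closed_hits X r i)"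
  unfolding closed_hits_def
  by (intro compact_Int_closed[OF compact_Icc] closed_INT ballI closed_UN closed_cball finite_atLeastAtMost)

lemma U_kappa_subset_closed_hits:
  "U_kappa T \<kappa> x \<subseteq> (\<Union>i. closed_hits (\<lambda>n. (T ^^ n) x) (\<lambda>N. real N powr (- \<kappa>)) i)"
proof
  fix y assume "y \<in> U_kappa T \<kappa> x"
  then obtain i where "y \<in> {0..1}"
    and "\<And>N. N \<in> {i..} \<Longrightarrow> \<exists>n\<in>{1..N}. dist ((T ^^ n) x) y < real N powr (- \<kappa>)"
    unfolding mem_U_kappa_iff by blast
  then have "y \<in> closed_hits (\<lambda>n. (T ^^ n) x) (\<lambda>N. real N powr (- \<kappa>)) i"
    unfolding mem_closed_hits_iff by (meson less_imp_le)
  then show "y \<in> (\<Union>i. closed_hits (\<lambda>n. (T ^^ n) x) (\<lambda>N. real N powr (- \<kappa>)) i)" by blast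
qed

lemma closed_hits_subset_U_kappa:
  "closed_hits (\<lambda>n. (T ^^ n) x) (\<lambda>N. real N powr (- \<kappa>)) i
   \<subseteq> U_kappa T \<kappa> x \<union> (\<Union>n. \<Union>N. {(T ^^ n) x - real N powr (- \<kappa>), (T ^^ n) x + real N powr (- \<kappa>)})"
proof
  fix y assume y: "y \<in> closed_hits (\<lambda>n. (T ^^ n) x) (\<lambda>N. real N powr (- \<kappa>)) i"
  show "y \<in> U_kappa T \<kappa> x \<union> (\<Union>n. \<Union>N. {(T ^^ n) x - real N powr (- \<kappa>), (T ^^ n) x + real N powr (- \<kappa>)})"
  proof (rule ccontr)
    assume n: "\<not> ?thesis"
    \<comment> \<open>The union in \<open>U_kappa\<close> starts at index 1, whereas
      \<open>i\<close> may be 0 here; hence \<open>max 1 i\<close>.\<close>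
    have *: "\<exists>n\<in>{1..N}. dist ((T ^^ n) x) y < real N powr (- \<kappa>)" if "N \<ge> max 1 i" for N
    proof -
      have "N \<in> {i..}" using that by simp
      then obtain n where "n \<in> {1..N}" "dist ((T ^^ n) x) y \<le> real N powr (- \<kappa>)"
        using y unfolding mem_closed_hits_iff by blast
      moreover have "dist ((T ^^ n) x) y \<noteq> real N powr (- \<kappa>)"
      proof
        assume "dist ((T ^^ n) x) y = real N powr (- \<kappa>)"
        then have "y = (T ^^ n) x - real N powr (- \<kappa>) \<or> y = (T ^^ n) x + real N powr (- \<kappa>)"
          by (auto simp: dist_real_def abs_if split: if_splits)
        then show False using n by blast
      qed
      ultimately show ?thesis by force
    qed
    have "\<exists>i\<in>{1..}. \<forall>N\<in>{i..}. \<exists>n\<in>{1..N}. dist ((T ^^ n) x) y < real N powr (- \<kappa>)"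
      by (rule bexI[of _ "max 1 i"], rule ballI, rule *) auto
    then have "y \<in> U_kappa T \<kappa> x"
      using y by (simp add: mem_U_kappa_iff mem_closed_hits_iff)
    then show False using n by simp
  qed
qed

text \<open>Passing to closed balls adds at most two points for each pair of a time and a radius, a
  countable and hence null set, and nullity is stable under countable unions.\<close>

lemma interval_null_U_kappa_iff:
  assumes "0 < s"
  shows "interval_null s (U_kappa T \<kappa> x) \<longleftrightarrow>
    (\<forall>i. interval_null s (closed_hits (\<lambda>n. (T ^^ n) x) (\<lambda>N. real N powr (- \<kappa>)) i))"
proof (intro iffI allI)
  fix i
  assume *: "interval_null s (U_kappa T \<kappa> x)"
  have "countable (\<Union>n. \<Union>N. {(T ^^ n) x - real N powr (- \<kappa>), (T ^^ n) x + real N powr (- \<kappa>)})"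
    by (intro countable_UN) auto
  from interval_null_mono[OF interval_null_Un_countable[OF * this assms] closed_hits_subset_U_kappa]
  show "interval_null s (closed_hits (\<lambda>n. (T ^^ n) x) (\<lambda>N. real N powr (- \<kappa>)) i)" .
next
  assume "\<forall>i. interval_null s (closed_hits (\<lambda>n. (T ^^ n) x) (\<lambda>N. real N powr (- \<kappa>)) i)"
  then show "interval_null s (U_kappa T \<kappa> x)"
    using interval_null_mono[OF interval_null_UN U_kappa_subset_closed_hits] by blast
qed

text \<open>Meeting \<open>C\<close> is approximated by finitely many strict conditions
  (\<open>N \<le> k\<close>, slack \<open>1 / Suc k\<close>), which can be tested on the dense
  subset \<open>D\<close>. Conversely, a limit in \<open>C\<close> of the approximate solutions
  satisfies all the exact closed conditions. For countable \<open>D\<close> the right-hand side is a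
  countable condition on \<open>X\<close>.\<close>

lemma closed_hits_meets_iff:
  assumes C: "compact C" "C \<subseteq> {0..1}" and D: "D \<subseteq> C" "C \<subseteq> closure D"
  shows "closed_hits X r i \<inter> C \<noteq> {} \<longleftrightarrow>
    (\<forall>k. \<exists>y\<in>D. \<forall>N\<in>{i..k}. \<exists>n\<in>{1..N}. dist (X n) y < r N + 1 / Suc k)"
proof (intro iffI allI)
  fix k
  assume "closed_hits X r i \<inter> C \<noteq> {}"
  then obtain y where y: "y \<in> C" "y \<in> closed_hits X r i" by blast
  obtain z where z: "z \<in> D" "dist z y < 1 / Suc k"
    using y(1) D(2) closure_approachable[of y D] by (meson subsetD of_nat_0_less_iff zero_less_Suc zero_less_divide_1_iff)
  have "\<exists>n\<in>{1..N}. dist (X n) z < r N + 1 / Suc k" if "N \<in> {i..k}" for N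
  proof -
    have "N \<in> {i..}" using that by simp
    then obtain n where n: "n \<in> {1..N}" "dist (X n) y \<le> r N"
      using y(2) unfolding mem_closed_hits_iff by blast
    have "dist (X n) z \<le> dist (X n) y + dist z y"
      by (metis dist_commute dist_triangle)
    then show ?thesis using n z by (intro bexI[of _ n]) auto
  qed
  with z(1) show "\<exists>y\<in>D. \<forall>N\<in>{i..k}. \<exists>n\<in>{1..N}. dist (X n) y < r N + 1 / Suc k" by blast
next
  assume "\<forall>k. \<exists>y\<in>D. \<forall>N\<in>{i..k}. \<exists>n\<in>{1..N}. dist (X n) y < r N + 1 / Suc k"
  then obtain y where y: "\<And>k. y k \<in> D"
    "\<And>k N. N \<in> {i..k} \<Longrightarrow> \<exists>n\<in>{1..N}. dist (X n) (y k) < r N + 1 / Suc k" by metis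
  obtain l \<phi> where l: "l \<in> C" "strict_mono (\<phi> :: nat \<Rightarrow> nat)" "(y \<circ> \<phi>) \<longlonglongrightarrow> l"
    using C(1) y(1) D(1) unfolding compact_def by (meson subsetD)
  have \<phi>: "filterlim \<phi> sequentially sequentially"
    using l(2) by (rule filterlim_subseq)
  have "\<exists>n\<in>{1..N}. dist (X n) l \<le> r N" if "N \<ge> i" for N
  proof (rule ccontr)
    assume "\<not> ?thesis"
    then have far: "r N < dist (X n) l" if "n \<in> {1..N}" for n using that by force
    have "eventually (\<lambda>j. r N + 1 / Suc (\<phi> j) < dist (X n) (y (\<phi> j))) sequentially"
      if "n \<in> {1..N}" for n
    proof -
      have "(\<lambda>j. dist (X n) (y (\<phi> j)) - (r N + 1 / Suc (\<phi> j))) \<longlonglongrightarrow> dist (X n) l - (r N + 0)"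
        using l(3) filterlim_compose[OF LIMSEQ_inverse_real_of_nat \<phi>]
        by (intro tendsto_intros) (auto simp: comp_def inverse_eq_divide)
      then have "eventually (\<lambda>j. 0 < dist (X n) (y (\<phi> j)) - (r N + 1 / Suc (\<phi> j))) sequentially"
        using far[OF that] by (intro order_tendstoD(1)) auto
      then show ?thesis by eventually_elim simp
    qed
    \<comment> \<open>For fixed \<open>N\<close> only finitely many \<open>n\<close> compete, so for
      large \<open>j\<close> all of them violate the relaxed bound at once.\<close>
    then have "eventually (\<lambda>j. \<forall>n\<in>{1..N}. r N + 1 / Suc (\<phi> j) < dist (X n) (y (\<phi> j))) sequentially"
      by (intro eventually_ball_finite) auto
    \<comment> \<open>As soon as \<open>\<phi> j \<ge> N\<close>, the condition at \<open>N\<close>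
      is among those that \<open>y (\<phi> j)\<close> satisfies.\<close>
    moreover have "eventually (\<lambda>j. \<phi> j \<ge> N) sequentially"
      using \<phi> by (simp add: filterlim_at_top)
    ultimately have "eventually (\<lambda>j. False) sequentially"
    proof eventually_elim
      case (elim j)
      then show ?case using y(2)[of N "\<phi> j"] that by force
    qed
    then show False by simp
  qed
  then have "l \<in> closed_hits X r i"
    using l(1) C(2) unfolding mem_closed_hits_iff by (meson atLeast_iff subsetD)
  with l(1) show "closed_hits X r i \<inter> C \<noteq> {}" by blast
qed

section \<open>Measurability of the Hausdorff dimension of \<open>U_kappa\<close>\<close>

lemma sets_closed_hits_subset_open:
  assumes X: "\<And>n. X n \<in> borel_measurable M" and V: "open V"
  shows "{x \<in> space M. closed_hits (\<lambda>n. X n x) r i \<subseteq> V} \<in> sets M"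
proof -
  \<comment> \<open>Lying inside \<open>V\<close> means missing the compact set \<open>C\<close>; a
    countable dense \<open>D\<close> in \<open>C\<close> turns this into a countable combination of
    measurable conditions.\<close>
  define C where "C = {0..1} - V"
  have C: "compact C" "C \<subseteq> {0..1}"
    using V by (auto simp: C_def compact_diff)
  obtain D where D: "countable D" "D \<subseteq> C" "C \<subseteq> closure D"
    using separable by blast
  have sub: "closed_hits X' r i \<subseteq> V \<longleftrightarrow> \<not> closed_hits X' r i \<inter> C \<noteq> {}" for X'
    unfolding C_def closed_hits_def by blast
  have [measurable]: "Measurable.pred M (\<lambda>x. dist (X n x) y < c)" for n y c
    using X[of n] by measurable
  have "{x \<in> space M. \<not> (\<forall>k. \<exists>y\<in>D. \<forall>N\<in>{i..k}. \<exists>n\<in>{1..N}. dist (X n x) y < r N + 1 / Suc k)} \<in> sets M"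
    using D(1) by measurable
  then show ?thesis
    unfolding sub closed_hits_meets_iff[OF C D(2,3)] .
qed

text \<open>Nullity is tested on each compact piece through inclusions in sets
  \<open>rat_cover L\<close>; the quantifiers over \<open>i\<close>, \<open>k\<close> and
  \<open>L\<close> are all countable.\<close>

lemma sets_interval_null_U_kappa:
  assumes "\<And>n. (T ^^ n) \<in> borel_measurable M" "0 < s"
  shows "{x \<in> space M. interval_null s (U_kappa T \<kappa> x)} \<in> sets M"
proof -
  let ?K = "\<lambda>i x. closed_hits (\<lambda>n. (T ^^ n) x) (\<lambda>N. real N powr (- \<kappa>)) i"
  have [measurable]: "Measurable.pred M (\<lambda>x. ?K i x \<subseteq> rat_cover L)" for i L
    using sets_closed_hits_subset_open[OF assms(1) open_rat_cover] by (simp add: pred_def)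
  have [simp]: "countable (small_rat_lists s \<epsilon>)" for \<epsilon>
    by (rule countableI_type)
  have "{x \<in> space M. \<forall>i k. \<exists>L\<in>small_rat_lists s (1 / Suc k). ?K i x \<subseteq> rat_cover L} \<in> sets M"
    by measurable
  then show ?thesis
    by (simp only: interval_null_U_kappa_iff[OF assms(2)] interval_null_compact_iff[OF compact_closed_hits])
qed

text \<open>Nullity passes to larger exponents, so an exponent below \<open>c\<close> can be raised
  to a rational one. Strict sublevel sets of the dimension thereby become countable unions.\<close>

lemma hausdorff_dim_less_iff:
  fixes E :: "real set"
  shows "hausdorff_dim E < c \<longleftrightarrow>
    (\<exists>r::rat. 0 < r \<and> ereal (of_rat r) < c \<and> interval_null (of_rat r) E)"
proof
  assume "hausdorff_dim E < c"
  then obtain s where s: "s > 0" "hausdorff_measure s E = 0" "ereal s < c"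
    unfolding hausdorff_dim_def INF_less_iff by blast
  obtain u where u: "ereal s < ereal u" "ereal u < c"
    using s(3) ereal_dense2 by blast
  then obtain r :: rat where r: "s < of_rat r" "of_rat r < u"
    using of_rat_dense[of s u] by auto
  have "interval_null (of_rat r) E"
    using interval_null_mono_exponent[of s E "of_rat r"] s r hausdorff_measure_eq_0_iff by auto
  moreover have "0 < r"
    using r s by (metis order_less_trans zero_less_of_rat_iff)
  moreover have "ereal (of_rat r) < c"
    using r u by (metis less_ereal.simps(1) order_less_trans)
  ultimately show "\<exists>r::rat. 0 < r \<and> ereal (of_rat r) < c \<and> interval_null (of_rat r) E" by blast
next
  assume "\<exists>r::rat. 0 < r \<and> ereal (of_rat r) < c \<and> interval_null (of_rat r) E"
  then show "hausdorff_dim E < c"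
    unfolding hausdorff_dim_def INF_less_iff
    by (metis (mono_tags, lifting) hausdorff_measure_eq_0_iff mem_Collect_eq zero_less_of_rat_iff)
qed

lemma borel_measurable_hausdorff_dim_U_kappa:
  assumes "\<And>n. (T ^^ n) \<in> borel_measurable M"
  shows "(\<lambda>x. hausdorff_dim (U_kappa T \<kappa> x)) \<in> borel_measurable M"
proof (rule borel_measurableI_less)
  fix c :: ereal
  have "{x \<in> space M. 0 < r \<and> ereal (of_rat r) < c \<and> interval_null (of_rat r) (U_kappa T \<kappa> x)} \<in> sets M"
    for r :: rat
    using sets_interval_null_U_kappa[OF assms, of "of_rat r" \<kappa>]
    by (cases "0 < r \<and> ereal (of_rat r) < c") auto
  then have "(\<Union>r::rat. {x \<in> space M. 0 < r \<and> ereal (of_rat r) < c \<and>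
      interval_null (of_rat r) (U_kappa T \<kappa> x)}) \<in> sets M"
    by (rule sets.countable_UN''[OF countableI_type])
  also have "(\<Union>r::rat. {x \<in> space M. 0 < r \<and> ereal (of_rat r) < c \<and>
      interval_null (of_rat r) (U_kappa T \<kappa> x)}) = {x \<in> space M. hausdorff_dim (U_kappa T \<kappa> x) < c}"
    by (auto simp: hausdorff_dim_less_iff)
  finally show "{x \<in> space M. hausdorff_dim (U_kappa T \<kappa> x) < c} \<in> sets M" .
qed

section \<open>Measurability of the Lebesgue measure of \<open>U_kappa\<close>\<close>

lemma sets_U_kappa: "U_kappa T \<kappa> x \<in> sets lborel"
proof -
  have "{y \<in> space lborel. y \<in> U_kappa T \<kappa> x} \<in> sets lborel"
    unfolding mem_U_kappa_iff atLeastAtMost_iff by measurable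
  then show ?thesis by simp
qed

text \<open>The pairs \<open>(x, y)\<close> with \<open>y\<close> in
  \<open>U_kappa T \<kappa> x\<close> form a product-measurable set, and Lebesgue measure being
  sigma-finite, the measure of its sections depends measurably on \<open>x\<close>.\<close>

lemma borel_measurable_measure_U_kappa:
  assumes [measurable]: "\<And>n. (T ^^ n) \<in> borel_measurable M"
  shows "(\<lambda>x. measure lborel (U_kappa T \<kappa> x)) \<in> borel_measurable M"
proof -
  have "(\<lambda>x. emeasure lborel (U_kappa T \<kappa> x)) \<in> borel_measurable M"
  proof (rule lborel.measurable_emeasure)
    show "{z \<in> space (M \<Otimes>\<^sub>M lborel). snd z \<in> U_kappa T \<kappa> (fst z)} \<in> sets (M \<Otimes>\<^sub>M lborel)"
      unfolding mem_U_kappa_iff atLeastAtMost_iff by measurable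
  qed auto
  then show ?thesis
    unfolding measure_def by measurable
qed

section \<open>Monotonicity of both quantities along orbits\<close>

lemma measure_U_kappa_le_shift:
  assumes "\<kappa> > 0"
  shows "measure lborel (U_kappa T \<kappa> x) \<le> measure lborel (U_kappa T \<kappa> (T x))"
proof -
  \<comment> \<open>Finiteness matters because \<open>measure\<close> takes the value 0 on sets of
    infinite measure, so monotonicity needs a finite larger set.\<close>
  have fin: "emeasure lborel (U_kappa T \<kappa> (T x) \<union> {T x}) < \<infinity>"
  proof (rule emeasure_bounded_finite)
    have "bounded (U_kappa T \<kappa> (T x))"
      by (rule bounded_subset[OF bounded_closed_interval[of 0 1]]) (auto simp: U_kappa_def)
    then show "bounded (U_kappa T \<kappa> (T x) \<union> {T x})" by simp
  qed
  have "measure lborel (U_kappa T \<kappa> x) \<le> measure lborel (U_kappa T \<kappa> (T x) \<union> {T x})"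
    using U_kappa_shift_subset[OF assms, of T x] sets_U_kappa[of T \<kappa> "T x"] fin
    by (intro measure_mono_fmeasurable sets_U_kappa fmeasurableI sets.Un) auto
  also have "\<dots> \<le> measure lborel (U_kappa T \<kappa> (T x)) + measure lborel {T x}"
    using sets_U_kappa by (intro measure_Un_le) auto
  finally show ?thesis by simp
qed

text \<open>The extra point \<open>T x\<close> is null for every s > 0, so each null exponent at
  \<open>T x\<close> is one at \<open>x\<close>, and the infimum at \<open>x\<close> runs over the
  larger set.\<close>

lemma hausdorff_dim_U_kappa_le_shift:
  assumes "\<kappa> > 0"
  shows "hausdorff_dim (U_kappa T \<kappa> x) \<le> hausdorff_dim (U_kappa T \<kappa> (T x))"
  unfolding hausdorff_dim_def
proof (rule INF_superset_mono)
  show "{s. 0 < s \<and> hausdorff_measure s (U_kappa T \<kappa> (T x)) = 0}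
      \<subseteq> {s. 0 < s \<and> hausdorff_measure s (U_kappa T \<kappa> x) = 0}"
    using interval_null_mono[OF interval_null_Un_countable U_kappa_shift_subset[OF assms, of T x]]
    by (auto simp: hausdorff_measure_eq_0_iff)
qed simp

theorem theorem1p1:
  fixes T :: "real \<Rightarrow> real" and \<nu> :: "real measure" and \<kappa> :: real
  assumes "expanding_markov_map T"
    and "invariant_ergodic_prob T \<nu>"
    and "\<kappa> > 0"
  shows "(\<exists>c::real. AE x in \<nu>. measure lborel (U_kappa T \<kappa> x) = c) \<and>
         (\<exists>d::ereal. AE x in \<nu>. hausdorff_dim (U_kappa T \<kappa> x) = d)"
proof -
  have prob: "prob_space \<nu>" and sets: "sets \<nu> = sets (restrict_space borel {0..1})"
    and T: "T \<in> measurable \<nu> \<nu>"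
    and inv: "\<And>A. A \<in> sets \<nu> \<Longrightarrow> emeasure \<nu> (T -` A \<inter> space \<nu>) = emeasure \<nu> A"
    and erg: "\<And>A. A \<in> sets \<nu> \<Longrightarrow> T -` A \<inter> space \<nu> = A \<Longrightarrow> emeasure \<nu> A = 0 \<or> emeasure \<nu> A = 1"
    using assms(2) unfolding invariant_ergodic_prob_def by auto
  interpret prob_space \<nu> by (rule prob)
  \<comment> \<open>Since \<nu> carries the trace Borel sets of the unit interval, the inclusion
    into the line is measurable; composed with the iterates it makes them real-valued measurable
    functions.\<close>
  have id: "(\<lambda>x. x) \<in> borel_measurable \<nu>"
    using measurable_restrict_space1[of "\<lambda>x. x" borel borel "{0..1}"]
    by (simp add: measurable_cong_sets[OF sets refl])
  have iter: "(T ^^ n) \<in> borel_measurable \<nu>" for n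
    using measurable_compose[OF measurable_compose_n[OF T, of n] id] by simp
  note const = AE_const_of_nondecreasing_along_orbits[OF T inv erg]
  \<comment> \<open>Embedding into \<open>ereal\<close> lets one ergodic argument serve both measure
    and dimension; \<open>real_of_ereal\<close> recovers the real constant.\<close>
  have "\<exists>d. AE x in \<nu>. ereal (measure lborel (U_kappa T \<kappa> x)) = d"
    using borel_measurable_measure_U_kappa[OF iter] measure_U_kappa_le_shift[OF assms(3)]
    by (intro const) auto
  then obtain d where d: "AE x in \<nu>. ereal (measure lborel (U_kappa T \<kappa> x)) = d" ..
  have "AE x in \<nu>. measure lborel (U_kappa T \<kappa> x) = real_of_ereal d"
    using d by eventually_elim auto
  moreover have "\<exists>d. AE x in \<nu>. hausdorff_dim (U_kappa T \<kappa> x) = d"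
    using borel_measurable_hausdorff_dim_U_kappa[OF iter] hausdorff_dim_U_kappa_le_shift[OF assms(3)]
    by (intro const) auto
  ultimately show ?thesis by blast
qed

end
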